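(* Let $X$ be a finite set and let $\lambda:X\to \mathrm{Sym}_X$ be an IYB map. Let $\mu:X^2\to \mathrm{Sym}_X$ be the map defined by $\mu(x,y)=\lambda(x)\lambda(y)$ for all $x,y\in X$. Let $\psi:\mathrm{Sym}_X\to \mathrm{Sym}_{X^2}$ be the map defined by $$\psi(\tau)(x,y)=\bigl(\tau(x),\ \lambda(\tau(x))^{-1}\,\tau\,\lambda(x)(y)\bigr)$$ for all $\tau\in \mathrm{Sym}_X$ and $x,y\in X$. Let $\lambda_2:X^2\to \mathrm{Sym}_{X^2}$ be the map $\lambda_2=\psi\mu$ (composition, $\mu$ first). Then $\lambda_2$ is an IYB map on $X^2$.
   Context: For a set $X$, $\mathrm{Sym}_X$ is the group of permutations of $X$ and $X^2=X\times X$. Products of permutations are compositions (right factor applied first). An involutive Yang-Baxter map (IYB map) on a finite set $X$ is a map $\lambda:X\to \mathrm{Sym}_X$ such that $\lambda(x)\,\lambda(\lambda(x)^{-1}(y))=\lambda(y)\,\lambda(\lambda(y)^{-1}(x))$ for all $x,y\in X$. *)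

theory Defs
  imports "HOL-Library.FuncSet" "HOL-Combinatorics.Permutations"
begin

text \<open>
  A permutation of a set \<open>X\<close> is represented by a function on the ambient type that
  permutes \<open>X\<close> and is the identity outside \<open>X\<close>. Such a function is a bijection of the whole
  type, so that \<open>inv\<close> is the group inverse and \<open>\<circ>\<close> the group product.
\<close>

definition Sym :: "'a set \<Rightarrow> ('a \<Rightarrow> 'a) set" where
  "Sym X = {p. p permutes X}"

definition IYB_map :: "'a set \<Rightarrow> ('a \<Rightarrow> 'a \<Rightarrow> 'a) \<Rightarrow> bool" where
  "IYB_map X l \<longleftrightarrow>
     l \<in> X \<rightarrow> Sym X \<and>
     (\<forall>x\<in>X. \<forall>y\<in>X. l x \<circ> l (inv (l x) y) = l y \<circ> l (inv (l y) x))"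

definition mu :: "('a \<Rightarrow> 'a \<Rightarrow> 'a) \<Rightarrow> 'a \<times> 'a \<Rightarrow> 'a \<Rightarrow> 'a" where
  "mu l = (\<lambda>(x, y). l x \<circ> l y)"

text \<open>The value outside \<open>X \<times> X\<close> is the identity, as the representation of \<open>Sym (X \<times> X)\<close> requires.\<close>

definition psi :: "'a set \<Rightarrow> ('a \<Rightarrow> 'a \<Rightarrow> 'a) \<Rightarrow> ('a \<Rightarrow> 'a) \<Rightarrow> 'a \<times> 'a \<Rightarrow> 'a \<times> 'a" where
  "psi X l \<tau> = (\<lambda>(x, y).
     if (x, y) \<in> X \<times> X then (\<tau> x, (inv (l (\<tau> x)) \<circ> \<tau> \<circ> l x) y) else (x, y))"

definition lambda2 :: "'a set \<Rightarrow> ('a \<Rightarrow> 'a \<Rightarrow> 'a) \<Rightarrow> 'a \<times> 'a \<Rightarrow> 'a \<times> 'a \<Rightarrow> 'a \<times> 'a" where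
  "lambda2 X l = psi X l \<circ> mu l"

lemma mu_in_Sym:
  assumes "l \<in> X \<rightarrow> Sym X"
  shows "mu l \<in> X \<times> X \<rightarrow> Sym X"
  using assms by (auto simp: mu_def Sym_def Pi_iff intro: permutes_compose)

lemma psi_in_Sym:
  assumes l: "l \<in> X \<rightarrow> Sym X"
  shows "psi X l \<in> Sym X \<rightarrow> Sym (X \<times> X)"
proof
  fix \<tau> assume "\<tau> \<in> Sym X"
  then have t: "\<tau> permutes X" by (simp add: Sym_def)
  have lp: "l x permutes X" if "x \<in> X" for x using l that by (auto simp: Sym_def)
  have mem: "psi X l s p \<in> X \<times> X" if s: "s permutes X" and p: "p \<in> X \<times> X" for s p
    using p permutes_in_image[OF s]
    by (auto simp: psi_def permutes_in_image[OF lp] permutes_in_image[OF permutes_inv[OF lp]])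
  have canc: "psi X l s' (psi X l s p) = p"
    if s: "s permutes X" and s': "s' permutes X" and ss: "\<And>x. s' (s x) = x" for s s' p
  proof (cases "p \<in> X \<times> X")
    case True
    then obtain x y where p: "p = (x, y)" "x \<in> X" "y \<in> X" by auto
    have sx: "s x \<in> X" using p permutes_in_image[OF s] by simp
    then show ?thesis using p mem[OF s True]
      by (simp add: psi_def ss permutes_inverses[OF lp] split: if_splits)
  next
    case False
    then show ?thesis by (cases p) (auto simp: psi_def)
  qed
  have i: "inv \<tau> permutes X" using permutes_inv[OF t] .
  have "bij (psi X l \<tau>)"
    by (rule o_bij[of "psi X l (inv \<tau>)"])
      (use canc[OF t i] canc[OF i t] permutes_inverses[OF t] in auto)
  moreover have "psi X l \<tau> p = p" if "p \<notin> X \<times> X" for p using that by (cases p) (auto simp: psi_def)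
  ultimately show "psi X l \<tau> \<in> Sym (X \<times> X)"
    by (simp add: Sym_def permutes_def bij_iff)
qed

end

theory Submission
  imports Defs
begin

text \<open>
  Two ideas carry the proof.

  Conjugating by the bijection \<open>J (x, y) = (x, l x y)\<close> of \<open>X \<times> X\<close> turns \<open>psi\<close> into the diagonal
  action: \<open>psi \<tau> = J\<^sup>-\<^sup>1 \<circ> (\<tau> \<times> \<tau>) \<circ> J\<close>. Hence \<open>psi\<close> is a homomorphism (\<open>psi_comp\<close>, \<open>inv_psi\<close>), and
  the Yang-Baxter equation for \<open>psi \<circ> mu\<close> reduces to an identity in \<open>Sym X\<close>.

  To state that identity, read each pair through \<open>J\<close>. The equation for \<open>l\<close> says that
  \<open>l a \<circ> l (inv (l a) b)\<close> is symmetric in \<open>a\<close> and \<open>b\<close>. It iterates: the product \<open>iyb_prod l as\<close>,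
  in which every entry is pulled back by the product of the entries before it, does not change
  when its entries are reordered, because each adjacent transposition is an instance of the
  equation for \<open>l\<close>; the case needed is \<open>iyb_prod_append_commute\<close>. In these terms
  \<open>mu l (x, y)\<close> is \<open>iyb_prod l [x, l x y]\<close>, and by \<open>iyb_prod_append\<close> the left-hand side of the
  equation for \<open>lambda2\<close> at \<open>(x, y)\<close> and \<open>(u, v)\<close> is the image under \<open>psi\<close> of
  \<open>iyb_prod l ([x, l x y] @ [u, l u v])\<close>. The right-hand side has the two blocks exchanged.
\<close>

lemma IYB_map_permutes:
  assumes "IYB_map X l" and "x \<in> X"
  shows "l x permutes X"
  using assms by (auto simp: IYB_map_def Sym_def)

lemma IYB_map_inv_in:
  assumes "IYB_map X l" and "x \<in> X" and "y \<in> X"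
  shows "inv (l x) y \<in> X"
  using permutes_in_image[OF permutes_inv[OF IYB_map_permutes[OF assms(1,2)]]] assms(3) by simp

text \<open>
  If \<open>l\<close> comes from a left brace on \<open>X\<close>, so that \<open>a + b = a \<cdot> inv (l a) b\<close>, then this is the action of
  the sum of the list. The symmetry below is the commutativity of that addition.
\<close>

function iyb_prod :: "('a \<Rightarrow> 'a \<Rightarrow> 'a) \<Rightarrow> 'a list \<Rightarrow> 'a \<Rightarrow> 'a" where
  "iyb_prod l [] = id"
| "iyb_prod l (a # as) = l a \<circ> iyb_prod l (map (inv (l a)) as)"
  by pat_completeness auto
termination by (relation "Wellfounded.measure (\<lambda>(l, as). length as)") auto

lemma iyb_prod_permutes:
  assumes "IYB_map X l" and "set as \<subseteq> X"
  shows "iyb_prod l as permutes X"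
  using assms(2)
proof (induction "length as" arbitrary: as)
  case 0
  then show ?case by (simp add: permutes_def)
next
  case (Suc n)
  then obtain a bs where as: "as = a # bs" "length bs = n" by (cases as) auto
  have "iyb_prod l (map (inv (l a)) bs) permutes X"
    using Suc.prems as IYB_map_inv_in[OF assms(1)] by (intro Suc.hyps(1)) auto
  then show ?case
    using as Suc.prems IYB_map_permutes[OF assms(1)] by (simp add: permutes_compose)
qed

lemma iyb_prod_append:
  assumes l: "IYB_map X l" and "set as \<subseteq> X"
  shows "iyb_prod l (as @ bs) = iyb_prod l as \<circ> iyb_prod l (map (inv (iyb_prod l as)) bs)"
  using assms(2)
proof (induction "length as" arbitrary: as bs)
  case 0
  then show ?case by (simp add: inv_id)
next
  case (Suc n)
  then obtain a cs where as: "as = a # cs" "length cs = n" by (cases as) auto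
  let ?c = "map (inv (l a)) cs"
  have a: "a \<in> X" using Suc.prems as by simp
  have c: "set ?c \<subseteq> X" using Suc.prems as IYB_map_inv_in[OF l a] by auto
  have inv: "inv (l a \<circ> iyb_prod l ?c) = inv (iyb_prod l ?c) \<circ> inv (l a)"
    using permutes_bij[OF IYB_map_permutes[OF l a]] permutes_bij[OF iyb_prod_permutes[OF l c]]
    by (rule o_inv_distrib)
  show ?case
    using Suc.hyps(1)[of ?c "map (inv (l a)) bs"] as c by (simp add: inv comp_assoc)
qed

text \<open>
  The tail is pulled back by the product of the first two entries alone, and the Yang-Baxter
  equation is the symmetry of that product.
\<close>

lemma iyb_prod_swap:
  assumes l: "IYB_map X l" and ab: "a \<in> X" "b \<in> X"
  shows "iyb_prod l (a # b # cs) = iyb_prod l (b # a # cs)"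
proof -
  have eq: "iyb_prod l [a, b] = iyb_prod l [b, a]"
    using assms by (simp add: IYB_map_def)
  have "iyb_prod l ([a, b] @ cs) = iyb_prod l ([b, a] @ cs)"
    using ab by (subst (1 2) iyb_prod_append[OF l]) (simp_all only: eq, simp_all)
  then show ?thesis by (simp only: append.simps)
qed

text \<open>
  Everything behind the head is pulled back by the same permutation, so a rearrangement of the
  tail can be carried out on the pulled-back list; this is how the inductions peel off the head.
\<close>

lemma iyb_prod_move_to_front:
  assumes l: "IYB_map X l" and "set as \<subseteq> X" and "b \<in> X"
  shows "iyb_prod l (as @ b # cs) = iyb_prod l (b # as @ cs)"
  using assms(2,3)
proof (induction "length as" arbitrary: as b cs)
  case 0
  then show ?case by simp
next
  case (Suc n)
  then obtain a ds where as: "as = a # ds" "length ds = n" by (cases as) auto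
  let ?f = "map (inv (l a))"
  have a: "a \<in> X" using Suc.prems as by simp
  have "iyb_prod l (?f ds @ inv (l a) b # ?f cs) = iyb_prod l (inv (l a) b # ?f ds @ ?f cs)"
    using Suc.prems as IYB_map_inv_in[OF l a] by (intro Suc.hyps(1)) auto
  then have "iyb_prod l (as @ b # cs) = iyb_prod l (a # b # ds @ cs)"
    by (simp add: as)
  also have "\<dots> = iyb_prod l (b # as @ cs)"
    unfolding as append_Cons by (rule iyb_prod_swap[OF l a Suc.prems(2)])
  finally show ?case .
qed

lemma iyb_prod_append_commute:
  assumes l: "IYB_map X l" and "set as \<subseteq> X" and "set bs \<subseteq> X"
  shows "iyb_prod l (as @ bs) = iyb_prod l (bs @ as)"
  using assms(2,3)
proof (induction "length as" arbitrary: as bs)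
  case 0
  then show ?case by simp
next
  case (Suc n)
  then obtain a ds where as: "as = a # ds" "length ds = n" by (cases as) auto
  let ?f = "map (inv (l a))"
  have a: "a \<in> X" using Suc.prems as by simp
  have "iyb_prod l (?f ds @ ?f bs) = iyb_prod l (?f bs @ ?f ds)"
    using Suc.prems as IYB_map_inv_in[OF l a] by (intro Suc.hyps(1)) auto
  then have "iyb_prod l (as @ bs) = iyb_prod l (a # bs @ ds)"
    by (simp add: as)
  also have "\<dots> = iyb_prod l (bs @ as)"
    using iyb_prod_move_to_front[OF l Suc.prems(2) a] by (simp add: as)
  finally show ?case .
qed

text \<open>
  In the second component the factor \<open>inv (l (t x))\<close> that ends the action of \<open>t\<close> cancels the
  factor \<open>l (t x)\<close> that begins the action of \<open>s\<close>, as it must for a conjugate of the diagonal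
  action.
\<close>

lemma psi_comp:
  fixes l :: "'a \<Rightarrow> 'a \<Rightarrow> 'a"
  assumes l: "IYB_map X l" and t: "t permutes X"
  shows "psi X l (s \<circ> t) = psi X l s \<circ> psi X l t"
proof
  fix p :: "'a \<times> 'a"
  obtain x y where p: "p = (x, y)" by (cases p)
  show "psi X l (s \<circ> t) p = (psi X l s \<circ> psi X l t) p"
    by (simp add: p psi_def permutes_in_image[OF t] permutes_in_image[OF IYB_map_permutes[OF l]]
        IYB_map_inv_in[OF l] permutes_inverses[OF IYB_map_permutes[OF l]])
qed

lemma psi_id:
  assumes "IYB_map X l"
  shows "psi X l id = id"
  by (auto simp: psi_def fun_eq_iff permutes_inverses[OF IYB_map_permutes[OF assms]])

lemma inv_psi:
  assumes l: "IYB_map X l" and t: "t permutes X"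
  shows "inv (psi X l t) = psi X l (inv t)"
proof (rule inv_unique_comp)
  show "psi X l t \<circ> psi X l (inv t) = id"
    using psi_comp[OF l permutes_inv[OF t], of t] permutes_inv_o[OF t] psi_id[OF l] by simp
  show "psi X l (inv t) \<circ> psi X l t = id"
    using psi_comp[OF l t, of "inv t"] permutes_inv_o[OF t] psi_id[OF l] by simp
qed

lemma mu_eq_iyb_prod:
  assumes "IYB_map X l" and "x \<in> X"
  shows "mu l (x, y) = iyb_prod l [x, l x y]"
  by (simp add: mu_def permutes_inverses[OF IYB_map_permutes[OF assms]])

text \<open>
  The factor \<open>l x\<close> that \<open>psi\<close> puts before \<open>\<tau>\<close> turns \<open>y\<close> into the second entry of the list, and the
  factor \<open>inv (l (\<tau> x))\<close> is the pull-back built into \<open>iyb_prod\<close>.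
\<close>

lemma mu_psi:
  assumes "x \<in> X" and "y \<in> X"
  shows "mu l (psi X l \<tau> (x, y)) = iyb_prod l (map \<tau> [x, l x y])"
  using assms by (simp add: psi_def mu_def)

text \<open>The right-hand side is symmetric in the two pairs by commutativity of \<open>iyb_prod\<close>.\<close>

lemma lambda2_comp_lambda2:
  assumes l: "IYB_map X l" and x: "x \<in> X" "y \<in> X" and u: "u \<in> X" "v \<in> X"
  shows "lambda2 X l (x, y) \<circ> lambda2 X l (inv (lambda2 X l (x, y)) (u, v))
       = psi X l (iyb_prod l ([x, l x y] @ [u, l u v]))"
proof -
  define s where "s = iyb_prod l [x, l x y]"
  define t where "t = iyb_prod l (map (inv s) [u, l u v])"
  have as: "set [x, l x y] \<subseteq> X" and bs: "set [u, l u v] \<subseteq> X"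
    using x u permutes_in_image[OF IYB_map_permutes[OF l]] by auto
  have s: "s permutes X" unfolding s_def by (rule iyb_prod_permutes[OF l as])
  have "set (map (inv s) [u, l u v]) \<subseteq> X"
    using bs permutes_in_image[OF permutes_inv[OF s]] by simp
  then have t: "t permutes X" unfolding t_def by (rule iyb_prod_permutes[OF l])
  have p: "lambda2 X l (x, y) = psi X l s"
    unfolding lambda2_def comp_apply s_def mu_eq_iyb_prod[OF l x(1)] ..
  have "lambda2 X l (inv (lambda2 X l (x, y)) (u, v)) = psi X l t"
    unfolding p inv_psi[OF l s] unfolding lambda2_def comp_apply t_def mu_psi[OF u] ..
  then have "lambda2 X l (x, y) \<circ> lambda2 X l (inv (lambda2 X l (x, y)) (u, v)) = psi X l (s \<circ> t)"
    using p psi_comp[OF l t] by simp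
  also have "s \<circ> t = iyb_prod l ([x, l x y] @ [u, l u v])"
    unfolding s_def t_def by (rule iyb_prod_append[OF l as, symmetric])
  finally show ?thesis .
qed

theorem lemma5p2:
  fixes X :: "'a set" and l :: "'a \<Rightarrow> 'a \<Rightarrow> 'a"
  assumes "finite X"
    and "IYB_map X l"
  shows "IYB_map (X \<times> X) (lambda2 X l)"
  unfolding IYB_map_def
proof (intro conjI ballI)
  have l: "l \<in> X \<rightarrow> Sym X" using assms(2) by (simp add: IYB_map_def)
  show "lambda2 X l \<in> X \<times> X \<rightarrow> Sym (X \<times> X)"
    unfolding lambda2_def using mu_in_Sym[OF l] psi_in_Sym[OF l] by (simp add: Pi_def)
next
  fix p q assume "p \<in> X \<times> X" "q \<in> X \<times> X"
  then obtain x y u v where p: "p = (x, y)" "x \<in> X" "y \<in> X" and q: "q = (u, v)" "u \<in> X" "v \<in> X"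
    by auto
  have "set [x, l x y] \<subseteq> X" "set [u, l u v] \<subseteq> X"
    using p q permutes_in_image[OF IYB_map_permutes[OF assms(2)]] by auto
  then have "iyb_prod l ([x, l x y] @ [u, l u v]) = iyb_prod l ([u, l u v] @ [x, l x y])"
    by (rule iyb_prod_append_commute[OF assms(2)])
  then show "lambda2 X l p \<circ> lambda2 X l (inv (lambda2 X l p) q)
    = lambda2 X l q \<circ> lambda2 X l (inv (lambda2 X l q) p)"
    unfolding p(1) q(1) lambda2_comp_lambda2[OF assms(2) p(2,3) q(2,3)]
      lambda2_comp_lambda2[OF assms(2) q(2,3) p(2,3)]
    by simp
qed

end
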